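(* Let $\rho\colon\mathbb{R}\to\mathbb{R}$ be any non-affine continuous function which is continuously differentiable at at least one point, with nonzero derivative at that point. Let $\mathcal{X}\subset\mathbb{R}^n$ be an instance space with probability measure $\mathcal{D}$, let $\mathcal{Y}=\{1,\dots,C\}$ be the finite label set, let $f\colon\mathcal{X}\to\mathcal{Y}$ be the labeling function, let $\mathcal{X}^{(c)}\subset\mathcal{X}$ be the set of points of class $c$, let $d$ be the metric used in adversarial attack, and let $\epsilon\ge0$. Suppose that the data points of any two different classes are $2\epsilon$-separable: $$\inf\{d(x^{(i)},x^{(j)})\colon x^{(i)}\in\mathcal{X}^{(i)},\ x^{(j)}\in\mathcal{X}^{(j)},\ i\ne j\}>2\epsilon.$$ Then there exists a feedforward neural network with $\rho$ as the activation function that has robust accuracy $1$ under adversarial attack of magnitude $\epsilon$.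
   Context: $d$ is a metric on $\mathbb{R}^n$ and $\mathrm{B}(x,\epsilon):=\{\tilde x\colon d(x,\tilde x)\le\epsilon\}$ is the $\epsilon$-neighborhood of $x$. $\mathcal{D}(A)$ is the probability of observing a data point in $A\subset\mathcal{X}$; $\mathcal{X}^{(c)}=\{x\in\mathcal{X}\colon f(x)=c\}$. Robust accuracy: a classifier $g\colon\mathbb{R}^n\to\mathbb{R}$ (whose prediction is the label nearest to its real output) has robust accuracy $\gamma$ under adversarial attack of magnitude $\epsilon\ge0$ if $$\gamma=\mathcal{D}\big(\{x\in\mathcal{X}\colon|g(\tilde x)-f(x)|<0.5\text{ for all }\tilde x\in\mathrm{B}(x,\epsilon)\}\big).$$ A feedforward neural network with activation $\rho$ is a function $\mathbb{R}^n\to\mathbb{R}$ that is a composition of finitely many affine maps, between consecutive ones of which $\rho$ is applied componentwise (any finite depth and widths are allowed; no activation is applied after the last affine map).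
   Formalization: Two hypotheses are added, as the claim fails without either: d is continuous for the usual topology of R^n, and the union of the ε-neighborhoods of points of X is bounded. (Counterexamples: ρ(x)=x² with parity labels on X=ℕ; discrete metric on {0}∪{1/k} with ε=0.) *)

theory Defs
  imports "HOL-Probability.Probability"
begin

definition affine_fun :: "(real \<Rightarrow> real) \<Rightarrow> bool" where
  "affine_fun \<rho> \<longleftrightarrow> (\<exists>a b. \<forall>x. \<rho> x = a * x + b)"

text \<open>Continuously differentiable at a point: differentiable in a neighbourhood of the point,
  with a derivative that is continuous at the point.\<close>

definition cont_diff_nonzero_at :: "(real \<Rightarrow> real) \<Rightarrow> real \<Rightarrow> bool" where
  "cont_diff_nonzero_at \<rho> a \<longleftrightarrow>
     (\<exists>\<rho>'. (\<forall>\<^sub>F x in nhds a. (\<rho> has_real_derivative \<rho>' x) (at x)) \<and> isCont \<rho>' a \<and> \<rho>' a \<noteq> 0)"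

text \<open>\<open>layers \<rho> m h\<close>: the map from \<open>real ^ 'n\<close> to m-dimensional space with components
  \<open>h x 0, \<dots>, h x (m - 1)\<close> is a composition of finitely many (at least one) affine maps, with \<open>\<rho>\<close>
  applied componentwise between consecutive ones. Hidden widths vary along the composition, so
  hidden vectors are functions on \<open>nat\<close> of which only the components below the width are used;
  \<open>W\<close> is the weight matrix (given by its rows in the first layer) and \<open>b\<close> the bias.\<close>

inductive layers :: "(real \<Rightarrow> real) \<Rightarrow> nat \<Rightarrow> (real ^ 'n \<Rightarrow> nat \<Rightarrow> real) \<Rightarrow> bool"
  for \<rho> :: "real \<Rightarrow> real" where
  first: "layers \<rho> m (\<lambda>x i. W i \<bullet> x + b i)"
| compose: "layers \<rho> k h \<Longrightarrow> layers \<rho> m (\<lambda>x i. (\<Sum>j<k. W i j * \<rho> (h x j)) + b i)"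

definition feedforward_network :: "(real \<Rightarrow> real) \<Rightarrow> (real ^ 'n \<Rightarrow> real) \<Rightarrow> bool" where
  "feedforward_network \<rho> g \<longleftrightarrow> (\<exists>h. layers \<rho> 1 h \<and> g = (\<lambda>x. h x 0))"

definition class_points :: "'a set \<Rightarrow> ('a \<Rightarrow> nat) \<Rightarrow> nat \<Rightarrow> 'a set" where
  "class_points X f c = {x \<in> X. f x = c}"

abbreviation nbhd :: "('a \<Rightarrow> 'a \<Rightarrow> real) \<Rightarrow> real \<Rightarrow> 'a \<Rightarrow> 'a set" where
  "nbhd d \<epsilon> x \<equiv> Metric_space.mcball UNIV d x \<epsilon>"

text \<open>The infimum is taken in \<open>ereal\<close>, so that it is \<open>\<infinity>\<close> if there are no two nonempty classes.\<close>

definition class_separation :: "'a set \<Rightarrow> ('a \<Rightarrow> nat) \<Rightarrow> ('a \<Rightarrow> 'a \<Rightarrow> real) \<Rightarrow> ereal" where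
  "class_separation X f d =
     Inf {ereal (d x y) | x y i j. x \<in> class_points X f i \<and> y \<in> class_points X f j \<and> i \<noteq> j}"

text \<open>The instance space X is \<open>space D\<close>. Non-measurable sets have \<open>measure\<close> 0, so robust accuracy 1
  entails measurability of the set in question.\<close>

definition robust_accuracy ::
  "'a measure \<Rightarrow> ('a \<Rightarrow> nat) \<Rightarrow> ('a \<Rightarrow> 'a \<Rightarrow> real) \<Rightarrow> real \<Rightarrow> ('a \<Rightarrow> real) \<Rightarrow> real" where
  "robust_accuracy D f d \<epsilon> g =
     measure D {x \<in> space D. \<forall>y \<in> nbhd d \<epsilon> x. \<bar>g y - real (f x)\<bar> < 1 / 2}"

end

theory Submission
  imports Defs
begin

text \<open>Balls of radius \<open>\<epsilon>\<close> around points of different classes have disjoint closures, so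
  the label is a continuous function on a compact set and it suffices to show that deep networks
  are dense in the continuous functions on a compact set. The functions that can be added,
  up to an arbitrarily small error, to the outputs of any network are closed under linear
  combinations, uniform limits and application of \<open>\<rho>\<close>, so by Stone-Weierstrass only squaring is
  missing. The average of \<open>\<rho>\<close> over intervals of length \<open>h\<close>, taken twice, is a uniform limit of
  Riemann sums of translates of \<open>\<rho>\<close>. It is twice continuously differentiable and its second
  derivative is a second difference of \<open>\<rho>\<close>, which is nonzero somewhere since \<open>\<rho>\<close> is not affine;
  rescaling it around such a point yields the square. Smoothness of \<open>\<rho>\<close> itself is needed only
  for the approximate identities, and \<open>\<rho>\<close> may be a polynomial.\<close>

section \<open>Real functions\<close>

lemma antiderivative_exists:
  fixes g :: "real \<Rightarrow> real"
  assumes "continuous_on UNIV g"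
  obtains G where "\<And>x. (G has_real_derivative g x) (at x)"
proof -
  have "\<exists>G. \<forall>x::real. -\<infinity> < ereal x \<longrightarrow> ereal x < \<infinity> \<longrightarrow> (G has_vector_derivative g x) (at x)"
    using assms by (intro einterval_antiderivative) (auto simp: continuous_on_eq_continuous_at)
  then obtain G where "\<And>x. (G has_vector_derivative g x) (at x)"
    by auto
  then show thesis
    by (intro that) (simp add: has_real_derivative_iff_has_vector_derivative)
qed

text \<open>The hypothesis is Jensen's equation \<open>g (y + h) + g (y - h) = 2 * g y\<close>.
  Integrating it in \<open>h\<close> writes \<open>g\<close> as a difference of values of its
  antiderivative, so \<open>g\<close> is differentiable; differentiating it in \<open>h\<close> then
  shows that the derivative is constant.\<close>

lemma affine_fun_if_second_differences_zero:
  fixes g :: "real \<Rightarrow> real"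
  assumes "continuous_on UNIV g"
    and "\<And>y h. 0 < h \<Longrightarrow> g (y + 2 * h) - 2 * g (y + h) + g y = 0"
  shows "affine_fun g"
proof -
  have pos: "g (y + h) + g (y - h) = 2 * g y" if "0 < h" for y h
    using assms(2)[OF that, of "y - h"] by (simp add: algebra_simps)
  have jensen: "g (y + h) + g (y - h) = 2 * g y" for y h
    using pos[of h y] pos[of "-h" y] by (cases h "0 :: real" rule: linorder_cases) auto
  obtain P where P: "\<And>x. (P has_real_derivative g x) (at x)"
    using antiderivative_exists[OF assms(1)] by blast
  have P': "((\<lambda>x. P (c + x)) has_real_derivative g (c + x)) (at x)"
    "((\<lambda>x. P (c - x)) has_real_derivative - g (c - x)) (at x)"
    "((\<lambda>x. P (x + c)) has_real_derivative g (x + c)) (at x)"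
    "((\<lambda>x. P (x - c)) has_real_derivative g (x - c)) (at x)" for c x
    by (rule DERIV_chain'[OF _ P, THEN DERIV_cong] derivative_eq_intros refl | simp)+
  \<comment> \<open>By Jensen's equation the difference of both sides, with 1 replaced by
    \<open>h\<close>, has derivative 0 in \<open>h\<close>, and it vanishes at
    \<open>h = 0\<close>.\<close>
  have average: "P (y + 1) - P (y - 1) = 2 * g y" for y
  proof -
    have "((\<lambda>h. P (y + h) - P (y - h) - 2 * h * g y) has_real_derivative 0) (at h)" for h
      using jensen[of y h] by (auto intro!: derivative_eq_intros P')
    then show ?thesis
      using DERIV_isconst_all[of "\<lambda>h. P (y + h) - P (y - h) - 2 * h * g y" 1 0] by simp
  qed
  define r where "r y = (g (y + 1) - g (y - 1)) / 2" for y
  \<comment> \<open>This function is \<open>g\<close> itself by \<open>average\<close>, so the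
    continuous function \<open>g\<close> gains a derivative.\<close>
  have "((\<lambda>y. (P (y + 1) - P (y - 1)) / 2) has_real_derivative r y) (at y)" for y
    unfolding r_def by (auto intro!: derivative_eq_intros P')
  then have r: "(g has_real_derivative r y) (at y)" for y
    by (simp add: average)
  have r': "((\<lambda>x. g (c + x)) has_real_derivative r (c + x)) (at x)"
    "((\<lambda>x. g (c - x)) has_real_derivative - r (c - x)) (at x)" for c x
    by (rule DERIV_chain'[OF _ r, THEN DERIV_cong] derivative_eq_intros refl | simp)+
  have "r u = r v" for u v
  proof -
    \<comment> \<open>With the midpoint fixed, the left side of Jensen's equation is constant in
      \<open>h\<close>, so its derivative \<open>r u - r v\<close> vanishes.\<close>
    define y h where "y = (u + v) / 2" and "h = (u - v) / 2"
    have "((\<lambda>h. g (y + h) + g (y - h)) has_real_derivative r (y + h) - r (y - h)) (at h)"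
      by (auto intro!: derivative_eq_intros r')
    then have "((\<lambda>h. 2 * g y) has_real_derivative r (y + h) - r (y - h)) (at h)"
      by (simp add: jensen)
    then have "r (y + h) - r (y - h) = 0"
      by (rule DERIV_unique) simp
    moreover have "y + h = u" "y - h = v"
      by (simp_all add: y_def h_def field_simps)
    ultimately show ?thesis by simp
  qed
  then have "((\<lambda>x. g x - r 0 * x) has_real_derivative 0) (at x)" for x
    using r[of x] by (auto intro!: derivative_eq_intros simp: \<open>\<And>u v. r u = r v\<close>[of x 0])
  then have "g x = r 0 * x + g 0" for x
    using DERIV_isconst_all[of "\<lambda>x. g x - r 0 * x" x 0] by (simp add: diff_eq_eq add.commute)
  then show ?thesis
    unfolding affine_fun_def by blast
qed

section \<open>Rescaling limits and Riemann sums, uniform on bounded intervals\<close>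

text \<open>Zooming in at a point with nonzero derivative makes \<open>g\<close> linear. With the
  activation for \<open>g\<close>, this lets a value pass through a layer almost unchanged.\<close>

lemma difference_quotient_near_identity:
  fixes g :: "real \<Rightarrow> real"
  assumes "(g has_real_derivative r) (at a)" "r \<noteq> 0" "0 < e"
  obtains t where "t \<noteq> 0"
    "\<And>y. \<bar>y\<bar> \<le> M \<Longrightarrow> \<bar>(g (a + t * y) - g a) / (t * r) - y\<bar> < e"
proof -
  \<comment> \<open>Relative linearization error that leaves \<open>e / 2\<close> after division by
    \<open>t * r\<close>; \<open>\<bar>M\<bar> + 1\<close> is positive for every
    \<open>M\<close>.\<close>
  define \<eta> where "\<eta> = e * \<bar>r\<bar> / (2 * (\<bar>M\<bar> + 1))"
  have "\<eta> > 0"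
    using assms by (simp add: \<eta>_def)
  moreover have "(g has_derivative (*) r) (at a)"
    using assms(1) by (simp add: has_field_derivative_def)
  ultimately obtain \<delta> where "\<delta> > 0"
    and \<delta>: "\<And>y. norm (y - a) < \<delta> \<Longrightarrow> norm (g y - g a - r * (y - a)) \<le> \<eta> * norm (y - a)"
    unfolding has_derivative_at_alt by blast
  define t where "t = \<delta> / (2 * (\<bar>M\<bar> + 1))"
  have t: "t > 0"
    using \<open>\<delta> > 0\<close> by (simp add: t_def)
  show thesis
  proof (rule that)
    show "t \<noteq> 0" using t by simp
    fix y :: real
    assume y: "\<bar>y\<bar> \<le> M"
    have "\<bar>t * y\<bar> \<le> t * (\<bar>M\<bar> + 1)"
      using y t by (auto simp: abs_mult intro!: mult_left_mono)
    also have "\<dots> < \<delta>"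
      using \<open>\<delta> > 0\<close> by (simp add: t_def field_simps add_pos_nonneg)
    finally have "\<bar>g (a + t * y) - g a - r * (t * y)\<bar> \<le> \<eta> * \<bar>t * y\<bar>"
      using \<delta>[of "a + t * y"] by simp
    also have "\<dots> \<le> \<eta> * (t * (\<bar>M\<bar> + 1))"
      using \<open>\<bar>t * y\<bar> \<le> _\<close> \<open>\<eta> > 0\<close> by simp
    also have "\<dots> = e * \<bar>t * r\<bar> / 2"
      using t by (simp add: \<eta>_def abs_mult field_simps)
    also have "\<dots> < e * \<bar>t * r\<bar>"
      using assms t by simp
    finally have "\<bar>g (a + t * y) - g a - r * (t * y)\<bar> / \<bar>t * r\<bar> < e"
      using assms t by (simp add: divide_less_eq)
    moreover have "(g (a + t * y) - g a) / (t * r) - y = (g (a + t * y) - g a - r * (t * y)) / (t * r)"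
      using assms t by (simp add: field_simps)
    ultimately show "\<bar>(g (a + t * y) - g a) / (t * r) - y\<bar> < e"
      by (simp add: abs_divide)
  qed
qed

text \<open>By Taylor's formula with Lagrange remainder the quotient equals
  \<open>y\<^sup>2 * s'' (p + z) / s'' p\<close> for some \<open>z\<close> between
  \<open>- \<bar>t * y\<bar>\<close> and \<open>\<bar>t * y\<bar>\<close>, and the ratio is near 1
  by continuity of \<open>s''\<close> at \<open>p\<close>.\<close>

lemma second_order_quotient_near_square:
  fixes s s' s'' :: "real \<Rightarrow> real"
  assumes "\<And>x. (s has_real_derivative s' x) (at x)"
    and "\<And>x. (s' has_real_derivative s'' x) (at x)"
    and "isCont s'' p" "s'' p \<noteq> 0" "0 < e"
  obtains t where "t \<noteq> 0"
    "\<And>y. \<bar>y\<bar> \<le> M \<Longrightarrow> \<bar>2 * (s (p + t * y) - s p - s' p * (t * y)) / (t\<^sup>2 * s'' p) - y\<^sup>2\<bar> < e"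
proof -
  define \<eta> where "\<eta> = e * \<bar>s'' p\<bar> / (2 * (\<bar>M\<bar> + 1)\<^sup>2)"
  have "\<eta> > 0"
    using assms by (simp add: \<eta>_def)
  then obtain \<delta> where "\<delta> > 0" and \<delta>: "\<And>x. \<bar>x - p\<bar> < \<delta> \<Longrightarrow> \<bar>s'' x - s'' p\<bar> < \<eta>"
    using assms(3) unfolding continuous_at_eps_delta dist_real_def by metis
  define t where "t = \<delta> / (2 * (\<bar>M\<bar> + 1))"
  have t: "t > 0"
    using \<open>\<delta> > 0\<close> by (simp add: t_def)
  show thesis
  proof (rule that)
    show "t \<noteq> 0" using t by simp
    fix y :: real
    assume y: "\<bar>y\<bar> \<le> M"
    have "\<bar>t * y\<bar> \<le> t * (\<bar>M\<bar> + 1)"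
      using y t by (auto simp: abs_mult intro!: mult_left_mono)
    also have "\<dots> < \<delta>"
      using \<open>\<delta> > 0\<close> by (simp add: t_def field_simps add_pos_nonneg)
    finally have small: "\<bar>t * y\<bar> < \<delta>" .
    \<comment> \<open>The derivative sequence for Maclaurin's theorem of order 2; only its entries
      0, 1 and 2 matter.\<close>
    define D where "D m = (if m = 0 then \<lambda>x. s (p + x) else if m = 1 then \<lambda>x. s' (p + x)
      else (\<lambda>x. s'' (p + x)))" for m :: nat
    have "((\<lambda>x. s (p + x)) has_real_derivative s' (p + x)) (at x)"
      "((\<lambda>x. s' (p + x)) has_real_derivative s'' (p + x)) (at x)" for x
      by (rule DERIV_chain'[OF _ assms(1), THEN DERIV_cong]
          DERIV_chain'[OF _ assms(2), THEN DERIV_cong] derivative_eq_intros refl | simp)+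
    then have "\<forall>m x. m < 2 \<and> \<bar>x\<bar> \<le> \<bar>t * y\<bar> \<longrightarrow> (D m has_real_derivative D (Suc m) x) (at x)"
      by (auto simp: D_def less_2_cases_iff)
    then obtain z where z: "\<bar>z\<bar> \<le> \<bar>t * y\<bar>"
      "s (p + t * y) = (\<Sum>m<2. D m 0 / fact m * (t * y) ^ m) + D 2 z / fact 2 * (t * y)\<^sup>2"
      using Maclaurin_bi_le[of D "\<lambda>x. s (p + x)" 2 "t * y"] by (auto simp: D_def)
    then have "s (p + t * y) - s p - s' p * (t * y) = s'' (p + z) * (t * y)\<^sup>2 / 2"
      by (simp add: D_def numeral_2_eq_2)
    then have "2 * (s (p + t * y) - s p - s' p * (t * y)) / (t\<^sup>2 * s'' p) - y\<^sup>2
        = (s'' (p + z) - s'' p) * y\<^sup>2 / s'' p"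
      using assms(4) t by (simp add: power_mult_distrib divide_simps) (simp add: algebra_simps)
    also have "\<bar>\<dots>\<bar> = \<bar>s'' (p + z) - s'' p\<bar> * y\<^sup>2 / \<bar>s'' p\<bar>"
      by (simp add: abs_mult abs_divide)
    also have "\<dots> \<le> \<eta> * (\<bar>M\<bar> + 1)\<^sup>2 / \<bar>s'' p\<bar>"
    proof (intro divide_right_mono mult_mono)
      show "\<bar>s'' (p + z) - s'' p\<bar> \<le> \<eta>"
        using \<delta>[of "p + z"] z(1) small by simp
      show "y\<^sup>2 \<le> (\<bar>M\<bar> + 1)\<^sup>2"
        using y by (subst power2_abs[symmetric], intro power_mono) auto
    qed (use \<open>\<eta> > 0\<close> in auto)
    also have "\<dots> = e / 2"
    proof -
      have "(\<bar>M\<bar> + 1)\<^sup>2 \<noteq> 0"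
        by (simp add: add_nonneg_eq_0_iff)
      then show ?thesis
        using assms(4) unfolding \<eta>_def by (simp add: field_simps)
    qed
    finally show "\<bar>2 * (s (p + t * y) - s p - s' p * (t * y)) / (t\<^sup>2 * s'' p) - y\<^sup>2\<bar> < e"
      using assms(5) by linarith
  qed
qed

text \<open>On each of \<open>N\<close> equal pieces the mean value theorem gives the increment of
  \<open>P\<close> as the length times a value of \<open>g\<close>. Uniform continuity of
  \<open>g\<close> makes one \<open>N\<close> serve all \<open>y\<close> with
  \<open>\<bar>y\<bar> \<le> M\<close>.\<close>

lemma riemann_sum_near_increment:
  fixes g P :: "real \<Rightarrow> real"
  assumes "continuous_on UNIV g" "\<And>x. (P has_real_derivative g x) (at x)" "0 < h" "0 < e"
  obtains N :: nat where
    "\<And>y. \<bar>y\<bar> \<le> M \<Longrightarrow> \<bar>(P (y + h) - P y) - (\<Sum>k<N. h / N * g (y + k * (h / N)))\<bar> < e"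
proof -
  \<comment> \<open>Contains \<open>{y..y + h}\<close> for every admissible
    \<open>y\<close>.\<close>
  define I where "I = {- \<bar>M\<bar> - h..\<bar>M\<bar> + h}"
  have "uniformly_continuous_on I g"
    unfolding I_def by (intro compact_uniformly_continuous continuous_on_subset[OF assms(1)]) auto
  then obtain \<delta> where "\<delta> > 0"
    and \<delta>: "\<And>x x'. x \<in> I \<Longrightarrow> x' \<in> I \<Longrightarrow> \<bar>x' - x\<bar> < \<delta> \<Longrightarrow> \<bar>g x' - g x\<bar> < e / (2 * h)"
    using assms(3,4) unfolding uniformly_continuous_on_def dist_real_def
    by (metis divide_pos_pos mult_pos_pos zero_less_numeral)
  obtain N :: nat where N: "h / \<delta> < N"
    using reals_Archimedean2 by blast
  have "0 < real N"
    by (rule le_less_trans[OF _ N]) (use assms(3) \<open>\<delta> > 0\<close> in auto)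
  define w where "w = h / N"
  have w: "0 < w" "w < \<delta>" "N * w = h"
    using assms(3) N \<open>\<delta> > 0\<close> \<open>0 < real N\<close> by (auto simp: w_def field_simps)
  show thesis
  proof (rule that)
    fix y :: real
    assume y: "\<bar>y\<bar> \<le> M"
    have step: "\<bar>P (y + Suc k * w) - P (y + k * w) - w * g (y + k * w)\<bar> \<le> w * (e / (2 * h))"
      if "k < N" for k
    proof -
      have "y + k * w < y + Suc k * w"
        using w by (simp add: algebra_simps)
      then obtain z where z: "y + k * w < z" "z < y + Suc k * w"
        "P (y + Suc k * w) - P (y + k * w) = (y + Suc k * w - (y + k * w)) * g z"
        using MVT2[of _ _ P g] assms(2) by blast
      have "Suc k * w \<le> N * w"
        using that w by (intro mult_right_mono) auto
      then have "Suc k * w \<le> h"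
        using w by simp
      moreover have "0 \<le> k * w"
        using w by simp
      moreover have "Suc k * w = k * w + w"
        by (simp add: algebra_simps)
      ultimately have "y + k * w \<in> I" "z \<in> I" "\<bar>z - (y + k * w)\<bar> < \<delta>"
        using z(1,2) y w(1,2) unfolding I_def atLeastAtMost_iff by linarith+
      then have "\<bar>g z - g (y + k * w)\<bar> \<le> e / (2 * h)"
        using \<delta> by (meson less_imp_le)
      moreover have "P (y + Suc k * w) - P (y + k * w) - w * g (y + k * w) = w * (g z - g (y + k * w))"
        using z(3) by (simp add: algebra_simps)
      ultimately show ?thesis
        using w by (simp only: abs_mult abs_of_pos mult_left_mono less_imp_le)
    qed
    have "P (y + h) - P y = (\<Sum>k<N. P (y + Suc k * w) - P (y + k * w))"
      using sum_lessThan_telescope[of "\<lambda>k. P (y + k * w)" N] w(3) by simp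
    then have "\<bar>(P (y + h) - P y) - (\<Sum>k<N. w * g (y + k * w))\<bar>
        = \<bar>\<Sum>k<N. P (y + Suc k * w) - P (y + k * w) - w * g (y + k * w)\<bar>"
      by (simp add: sum_subtractf)
    also have "\<dots> \<le> (\<Sum>k<N. w * (e / (2 * h)))"
      by (rule order_trans[OF sum_abs sum_mono]) (use step in auto)
    also have "\<dots> = N * w * (e / (2 * h))"
      by simp
    also have "\<dots> < e"
      using w assms(3,4) by simp
    finally show "\<bar>(P (y + h) - P y) - (\<Sum>k<N. h / N * g (y + k * (h / N)))\<bar> < e"
      unfolding w_def .
  qed
qed

section \<open>Networks\<close>

text \<open>No activation follows the last affine map, so a further affine map is absorbed into it
  without a new layer.\<close>

lemma layers_affine:
  assumes "layers \<rho> k h"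
  shows "layers \<rho> m (\<lambda>x i. (\<Sum>j<k. A i j * h x j) + c i)"
  using assms
proof cases
  case (first W b)
  have "(\<lambda>x i. (\<Sum>j<k. A i j * h x j) + c i) =
      (\<lambda>x i. (\<Sum>j<k. A i j *\<^sub>R W j) \<bullet> x + ((\<Sum>j<k. A i j * b j) + c i))"
    by (simp add: first inner_sum_left sum.distrib algebra_simps)
  then show ?thesis
    by (simp only: layers.first)
next
  case (compose l h' W b)
  have *: "(\<Sum>j<k. A i j * h x j) + c i
      = (\<Sum>q<l. (\<Sum>j<k. A i j * W j q) * \<rho> (h' x q)) + ((\<Sum>j<k. A i j * b j) + c i)" for x i
  proof -
    have "(\<Sum>j<k. A i j * h x j) = (\<Sum>j<k. \<Sum>q<l. A i j * W j q * \<rho> (h' x q)) + (\<Sum>j<k. A i j * b j)"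
      by (simp add: compose sum.distrib algebra_simps sum_distrib_left)
    also have "(\<Sum>j<k. \<Sum>q<l. A i j * W j q * \<rho> (h' x q)) = (\<Sum>q<l. (\<Sum>j<k. A i j * W j q) * \<rho> (h' x q))"
      by (subst sum.swap) (simp add: sum_distrib_right)
    finally show ?thesis by simp
  qed
  show ?thesis
    unfolding * by (rule layers.compose[OF compose(2)])
qed

lemma sum_diagonal:
  fixes u :: "'a :: semiring_0"
  assumes "i < (k :: nat)"
  shows "(\<Sum>j<k. (if i = j then u else 0) * z j) = u * z i"
proof -
  have "(\<Sum>j<k. (if i = j then u else 0) * z j) = (\<Sum>j<k. if i = j then u * z j else 0)"
    by (intro sum.cong) auto
  then show ?thesis
    using assms by simp
qed

text \<open>Appends one free row at index \<open>k\<close> while all old components undergo a common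
  affine map: the identity for linear combinations, a zoom to a point of differentiability before an
  activation.\<close>

lemma layers_extend:
  assumes "layers \<rho> k h"
  obtains h' where "layers \<rho> (Suc k) h'" "\<And>x i. i < k \<Longrightarrow> h' x i = u * h x i + v"
    "\<And>x. h' x k = (\<Sum>j<k. w j * h x j) + c"
proof -
  define A where "A i j = (if i = k then w j else if i = j then u else 0)" for i j
  define b where "b i = (if i = k then c else v)" for i
  show thesis
    using layers_affine[OF assms, of "Suc k" A b]
    by (rule that) (simp_all add: A_def b_def sum_diagonal)
qed

text \<open>A layer with diagonal weights. The factors \<open>u i\<close> and offsets
  \<open>v i\<close> allow a zoom made before the activation to be undone after it.\<close>

lemma layers_activate:
  assumes "layers \<rho> k h"
  obtains h' where "layers \<rho> k h'" "\<And>x i. i < k \<Longrightarrow> h' x i = u i * \<rho> (h x i) + v i"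
  using layers.compose[OF assms, of k "\<lambda>i j. if i = j then u i else 0" v]
  by (rule that) (simp add: sum_diagonal)

section \<open>Approximation by networks\<close>

text \<open>In \<open>jointly_approx\<close> a single network computes all functions of \<open>A\<close>. Those already computed
  are carried to the next layer by difference quotients of \<open>\<rho>\<close>, so networks of different
  depths never have to be put in parallel.\<close>

definition jointly_approx ::
  "(real \<Rightarrow> real) \<Rightarrow> (real ^ 'n) set \<Rightarrow> (real ^ 'n \<Rightarrow> real) set \<Rightarrow> bool" where
  "jointly_approx \<rho> K A \<longleftrightarrow>
     (\<forall>e>0. \<exists>k h. layers \<rho> k h \<and> (\<forall>F\<in>A. \<exists>i<k. \<forall>x\<in>K. \<bar>h x i - F x\<bar> < e))"

text \<open>Kept in every family of computed functions, so that the inputs remain available at any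
  depth.\<close>

definition coords :: "(real ^ 'n \<Rightarrow> real) set" where
  "coords = range (\<lambda>i x. x $ i)"

text \<open>Quantifying over all families \<open>A\<close> already computed makes the notion
  composable: several computable functions are appended one after another. Finiteness and continuity
  of \<open>A\<close> give a common bound on a compact \<open>K\<close>, needed for carrying its
  members through a layer.\<close>

definition computable :: "(real \<Rightarrow> real) \<Rightarrow> (real ^ 'n) set \<Rightarrow> (real ^ 'n \<Rightarrow> real) set" where
  "computable \<rho> K = {F. continuous_on K F \<and>
     (\<forall>A. finite A \<longrightarrow> (\<forall>G\<in>A. continuous_on K G) \<longrightarrow> coords \<subseteq> A \<longrightarrow>
        jointly_approx \<rho> K A \<longrightarrow> jointly_approx \<rho> K (insert F A))}"

text \<open>Reduces the construction of squaring to functions of one variable, where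
  \<open>\<rho>\<close> can be translated, averaged and rescaled.\<close>

definition applicable :: "(real \<Rightarrow> real) \<Rightarrow> (real ^ 'n) set \<Rightarrow> (real \<Rightarrow> real) set" where
  "applicable \<rho> K = {G. continuous_on UNIV G \<and> (\<forall>F\<in>computable \<rho> K. (\<lambda>x. G (F x)) \<in> computable \<rho> K)}"

section \<open>Extending jointly approximated families\<close>

lemma jointly_approx_mono: "jointly_approx \<rho> K B \<Longrightarrow> A \<subseteq> B \<Longrightarrow> jointly_approx \<rho> K A"
  unfolding jointly_approx_def by (meson subsetD)

lemma jointly_approxE:
  assumes "jointly_approx \<rho> K A" "0 < e"
  obtains k h where "layers \<rho> k h" "\<And>F. F \<in> A \<Longrightarrow> \<exists>i<k. \<forall>x\<in>K. \<bar>h x i - F x\<bar> < e"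
  using assms unfolding jointly_approx_def by metis

text \<open>A single affine layer whose rows are the standard basis vectors computes the coordinates
  exactly.\<close>

lemma jointly_approx_coords: "jointly_approx \<rho> K (coords :: (real ^ 'n \<Rightarrow> real) set)"
  unfolding jointly_approx_def
proof (intro allI impI)
  fix e :: real
  assume "0 < e"
  obtain u :: "nat \<Rightarrow> 'n" where u: "bij_betw u {0..<CARD('n)} UNIV"
    using ex_bij_betw_nat_finite[of "UNIV :: 'n set"] by auto
  have "layers \<rho> CARD('n) (\<lambda>x i. axis (u i) 1 \<bullet> x + 0)"
    by (rule layers.first)
  moreover have "\<exists>i<CARD('n). \<forall>x\<in>K. \<bar>axis (u i) 1 \<bullet> x + 0 - F x\<bar> < e" if "F \<in> coords" for F
  proof -
    obtain q where "F = (\<lambda>x. x $ q)"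
      using \<open>F \<in> coords\<close> by (auto simp: coords_def)
    moreover obtain i where "i < CARD('n)" "u i = q"
      using bij_betw_imp_surj_on[OF u] by (metis UNIV_I atLeastLessThan_iff imageE)
    ultimately show ?thesis
      using \<open>0 < e\<close> by (auto simp: inner_axis')
  qed
  ultimately show "\<exists>k h. layers \<rho> k h \<and> (\<forall>F\<in>coords. \<exists>i<k. \<forall>x\<in>K. \<bar>h x i - F x\<bar> < e)"
    by blast
qed

lemma jointly_approx_linear:
  assumes "jointly_approx \<rho> K A" "F \<in> A" "G \<in> A"
  shows "jointly_approx \<rho> K (insert (\<lambda>x. a * F x + b * G x + c) A)"
  unfolding jointly_approx_def
proof (intro allI impI)
  fix e :: real
  assume "0 < e"
  \<comment> \<open>The summand 1 avoids division by 0 and also ensures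
    \<open>\<eta> \<le> e\<close>, which the old functions need.\<close>
  define \<eta> where "\<eta> = e / (\<bar>a\<bar> + \<bar>b\<bar> + 1)"
  have \<eta>: "0 < \<eta>" "\<eta> \<le> e" "(\<bar>a\<bar> + \<bar>b\<bar> + 1) * \<eta> = e"
    using \<open>0 < e\<close> by (auto simp: \<eta>_def divide_simps add_nonneg_eq_0_iff intro: add_nonneg_pos)
  obtain k h where h: "layers \<rho> k h" "\<And>F. F \<in> A \<Longrightarrow> \<exists>i<k. \<forall>x\<in>K. \<bar>h x i - F x\<bar> < \<eta>"
    using jointly_approxE[OF assms(1) \<eta>(1)] by blast
  obtain i where i: "i < k" "\<And>x. x \<in> K \<Longrightarrow> \<bar>h x i - F x\<bar> < \<eta>"
    using h(2)[OF assms(2)] by blast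
  obtain j where j: "j < k" "\<And>x. x \<in> K \<Longrightarrow> \<bar>h x j - G x\<bar> < \<eta>"
    using h(2)[OF assms(3)] by blast
  \<comment> \<open>A sum of two terms, so that the weights add up if \<open>F\<close> and
    \<open>G\<close> are read from the same component.\<close>
  define w where "w l = (if i = l then a else 0) + (if j = l then b else 0)" for l
  obtain h' where h': "layers \<rho> (Suc k) h'" "\<And>x i. i < k \<Longrightarrow> h' x i = 1 * h x i + 0"
    "\<And>x. h' x k = (\<Sum>l<k. w l * h x l) + c"
    using layers_extend[OF h(1), where u = 1 and v = 0 and w = w and c = c] by blast
  have new: "h' x k = a * h x i + b * h x j + c" for x
    using i(1) j(1) by (simp add: h'(3) w_def distrib_right sum.distrib sum_diagonal)
  have "\<bar>h' x k - (a * F x + b * G x + c)\<bar> < e" if "x \<in> K" for x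
  proof -
    have "h' x k - (a * F x + b * G x + c) = a * (h x i - F x) + b * (h x j - G x)"
      by (simp add: new algebra_simps)
    also have "\<bar>\<dots>\<bar> \<le> \<bar>a\<bar> * \<bar>h x i - F x\<bar> + \<bar>b\<bar> * \<bar>h x j - G x\<bar>"
      by (rule order_trans[OF abs_triangle_ineq]) (simp add: abs_mult)
    also have "\<dots> \<le> \<bar>a\<bar> * \<eta> + \<bar>b\<bar> * \<eta>"
      using i(2)[OF that] j(2)[OF that] by (intro add_mono mult_left_mono) auto
    also have "\<dots> < (\<bar>a\<bar> + \<bar>b\<bar> + 1) * \<eta>"
      using \<eta>(1) by (simp add: distrib_right)
    finally show ?thesis using \<eta>(3) by simp
  qed
  moreover have "\<exists>i<Suc k. \<forall>x\<in>K. \<bar>h' x i - F x\<bar> < e" if "F \<in> A" for F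
  proof -
    obtain i where "i < k" "\<And>x. x \<in> K \<Longrightarrow> \<bar>h x i - F x\<bar> < \<eta>"
      using h(2)[OF \<open>F \<in> A\<close>] by blast
    then have "i < Suc k \<and> (\<forall>x\<in>K. \<bar>h' x i - F x\<bar> < e)"
      using h'(2) \<eta>(2) by (auto intro: less_le_trans)
    then show ?thesis ..
  qed
  ultimately show "\<exists>k h. layers \<rho> k h \<and>
      (\<forall>F\<in>insert (\<lambda>x. a * F x + b * G x + c) A. \<exists>i<k. \<forall>x\<in>K. \<bar>h x i - F x\<bar> < e)"
    using h'(1) by (intro exI[of _ "Suc k"] exI[of _ h']) blast
qed

text \<open>One new layer: a copy of the component for \<open>F\<close> is activated as it is, while
  the old components are zoomed to \<open>p\<close>, activated and zoomed back, which turns them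
  into difference quotients of \<open>\<rho>\<close> near the identity.\<close>

lemma jointly_approx_activation:
  assumes "jointly_approx \<rho> K A" "F \<in> A"
    and "\<And>G x. G \<in> A \<Longrightarrow> x \<in> K \<Longrightarrow> \<bar>G x\<bar> \<le> M"
    and "continuous_on UNIV \<rho>" "(\<rho> has_real_derivative r) (at p)" "r \<noteq> 0"
  shows "jointly_approx \<rho> K (insert (\<lambda>x. \<rho> (F x)) A)"
  unfolding jointly_approx_def
proof (intro allI impI)
  fix e :: real
  assume "0 < e"
  \<comment> \<open>The members of \<open>A\<close> are bounded by \<open>M\<close>, and their
    approximations within \<open>\<eta> \<le> 1\<close> by \<open>M + 1\<close>.\<close>
  have "uniformly_continuous_on {- (M + 1)..M + 1} \<rho>"
    by (intro compact_uniformly_continuous continuous_on_subset[OF assms(4)]) auto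
  then obtain \<delta> where "\<delta> > 0"
    and \<delta>: "\<And>y z. \<bar>y\<bar> \<le> M + 1 \<Longrightarrow> \<bar>z\<bar> \<le> M + 1 \<Longrightarrow> \<bar>y - z\<bar> < \<delta> \<Longrightarrow> \<bar>\<rho> y - \<rho> z\<bar> < e"
    using \<open>0 < e\<close> unfolding uniformly_continuous_on_def dist_real_def
    by (metis abs_le_iff atLeastAtMost_iff minus_le_iff)
  define \<eta> where "\<eta> = min (e / 2) (min \<delta> 1)"
  have \<eta>: "0 < \<eta>" "\<eta> \<le> e / 2" "\<eta> \<le> \<delta>" "\<eta> \<le> 1"
    using \<open>0 < e\<close> \<open>\<delta> > 0\<close> by (auto simp: \<eta>_def)
  obtain k h where h: "layers \<rho> k h" "\<And>F. F \<in> A \<Longrightarrow> \<exists>i<k. \<forall>x\<in>K. \<bar>h x i - F x\<bar> < \<eta>"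
    using jointly_approxE[OF assms(1) \<eta>(1)] by blast
  obtain j where j: "j < k" "\<And>x. x \<in> K \<Longrightarrow> \<bar>h x j - F x\<bar> < \<eta>"
    using h(2)[OF assms(2)] by blast
  have "0 < e / 2"
    using \<open>0 < e\<close> by simp
  then obtain t where t: "t \<noteq> 0"
    "\<And>y. \<bar>y\<bar> \<le> M + 1 \<Longrightarrow> \<bar>(\<rho> (p + t * y) - \<rho> p) / (t * r) - y\<bar> < e / 2"
    using difference_quotient_near_identity[OF assms(5,6)] by metis
  define w :: "nat \<Rightarrow> real" where "w l = (if j = l then 1 else 0)" for l
  obtain h' where h': "layers \<rho> (Suc k) h'" "\<And>x i. i < k \<Longrightarrow> h' x i = t * h x i + p"
    "\<And>x. h' x k = (\<Sum>l<k. w l * h x l) + 0"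
    using layers_extend[OF h(1), where u = t and v = p and w = w and c = 0] by blast
  \<comment> \<open>\<open>u\<close> and \<open>v\<close> undo the zoom on the old components and
    leave the new one, at index \<open>k\<close>, unchanged.\<close>
  define u where "u i = (if i = k then 1 else 1 / (t * r))" for i
  define v where "v i = (if i = k then 0 else - \<rho> p / (t * r))" for i
  obtain g where g: "layers \<rho> (Suc k) g" "\<And>x i. i < Suc k \<Longrightarrow> g x i = u i * \<rho> (h' x i) + v i"
    using layers_activate[OF h'(1), where u = u and v = v] by blast
  have new: "g x k = \<rho> (h x j)" for x
    using j(1) by (simp add: g(2) h'(3) u_def v_def w_def sum_diagonal)
  have old: "g x i = (\<rho> (p + t * h x i) - \<rho> p) / (t * r)" if "i < k" for x i
    using that by (simp add: g(2) h'(2) u_def v_def add.commute diff_divide_distrib)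
  have "\<bar>g x k - \<rho> (F x)\<bar> < e" if "x \<in> K" for x
    unfolding new using assms(3)[OF assms(2) that] j(2)[OF that] \<eta> by (intro \<delta>) linarith+
  moreover have "\<exists>i<Suc k. \<forall>x\<in>K. \<bar>g x i - G x\<bar> < e" if "G \<in> A" for G
  proof -
    obtain i where i: "i < k" "\<And>x. x \<in> K \<Longrightarrow> \<bar>h x i - G x\<bar> < \<eta>"
      using h(2)[OF \<open>G \<in> A\<close>] by blast
    have "\<bar>g x i - G x\<bar> < e" if "x \<in> K" for x
    proof -
      have "\<bar>h x i\<bar> \<le> M + 1"
        using assms(3)[OF \<open>G \<in> A\<close> that] i(2)[OF that] \<eta>(4) by linarith
      then have "\<bar>g x i - h x i\<bar> < e / 2"
        unfolding old[OF i(1)] by (rule t(2))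
      then show ?thesis
        using i(2)[OF that] \<eta>(2) by linarith
    qed
    then show ?thesis
      using i(1) less_SucI by blast
  qed
  ultimately show "\<exists>k h. layers \<rho> k h \<and>
      (\<forall>G\<in>insert (\<lambda>x. \<rho> (F x)) A. \<exists>i<k. \<forall>x\<in>K. \<bar>h x i - G x\<bar> < e)"
    using g(1) by (intro exI[of _ "Suc k"] exI[of _ g]) blast
qed

lemma jointly_approx_limit:
  assumes "\<And>e. 0 < e \<Longrightarrow> \<exists>G. jointly_approx \<rho> K (insert G A) \<and> (\<forall>x\<in>K. \<bar>G x - F x\<bar> < e)"
  shows "jointly_approx \<rho> K (insert F A)"
  unfolding jointly_approx_def
proof (intro allI impI)
  fix e :: real
  assume "0 < e"
  then have e2: "0 < e / 2"
    by simp
  then obtain G where G: "jointly_approx \<rho> K (insert G A)" "\<And>x. x \<in> K \<Longrightarrow> \<bar>G x - F x\<bar> < e / 2"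
    using assms by meson
  obtain k h where h: "layers \<rho> k h" "\<And>H. H \<in> insert G A \<Longrightarrow> \<exists>i<k. \<forall>x\<in>K. \<bar>h x i - H x\<bar> < e / 2"
    using jointly_approxE[OF G(1) e2] by blast
  have "\<exists>i<k. \<forall>x\<in>K. \<bar>h x i - H x\<bar> < e" if "H \<in> insert F A" for H
  proof (cases "H = F")
    case True
    obtain i where i: "i < k" "\<And>x. x \<in> K \<Longrightarrow> \<bar>h x i - G x\<bar> < e / 2"
      using h(2)[of G] by blast
    have "\<bar>h x i - F x\<bar> < e" if "x \<in> K" for x
      using i(2)[OF that] G(2)[OF that] by linarith
    then show ?thesis
      using True i(1) by blast
  next
    case False
    then obtain i where i: "i < k" "\<And>x. x \<in> K \<Longrightarrow> \<bar>h x i - H x\<bar> < e / 2"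
      using h(2)[of H] \<open>H \<in> insert F A\<close> by blast
    have "\<bar>h x i - H x\<bar> < e" if "x \<in> K" for x
      using i(2)[OF that] \<open>0 < e\<close> by linarith
    then show ?thesis
      using i(1) by blast
  qed
  then show "\<exists>k h. layers \<rho> k h \<and> (\<forall>H\<in>insert F A. \<exists>i<k. \<forall>x\<in>K. \<bar>h x i - H x\<bar> < e)"
    using h(1) by blast
qed

section \<open>Closure properties of the computable functions\<close>

lemma computable_continuous: "F \<in> computable \<rho> K \<Longrightarrow> continuous_on K F"
  by (simp add: computable_def)

lemma computable_insert:
  assumes "F \<in> computable \<rho> K" "finite A" "\<And>G. G \<in> A \<Longrightarrow> continuous_on K G" "coords \<subseteq> A"
    "jointly_approx \<rho> K A"
  shows "jointly_approx \<rho> K (insert F A)"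
  using assms by (simp add: computable_def)

text \<open>Both arguments are appended to the family in turn, then their combination; finally the
  arguments are dropped.\<close>

lemma computable_linear:
  assumes "F \<in> computable \<rho> K" "G \<in> computable \<rho> K"
  shows "(\<lambda>x. a * F x + b * G x + c) \<in> computable \<rho> K"
  unfolding computable_def
proof (intro CollectI conjI allI impI)
  show "continuous_on K (\<lambda>x. a * F x + b * G x + c)"
    by (intro continuous_intros computable_continuous[OF assms(1)] computable_continuous[OF assms(2)])
  fix A :: "(real ^ 'a \<Rightarrow> real) set"
  assume A: "finite A" "\<forall>G\<in>A. continuous_on K G" "coords \<subseteq> A" "jointly_approx \<rho> K A"
  then have "jointly_approx \<rho> K (insert G A)"
    by (intro computable_insert[OF assms(2)]) auto
  then have "jointly_approx \<rho> K (insert F (insert G A))"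
    using A computable_continuous[OF assms(2)] by (intro computable_insert[OF assms(1)]) auto
  then have "jointly_approx \<rho> K (insert (\<lambda>x. a * F x + b * G x + c) (insert F (insert G A)))"
    by (intro jointly_approx_linear) auto
  then show "jointly_approx \<rho> K (insert (\<lambda>x. a * F x + b * G x + c) A)"
    by (rule jointly_approx_mono) auto
qed

lemma computable_coord: "(\<lambda>x. x $ i) \<in> computable \<rho> K"
  unfolding computable_def
proof (intro CollectI conjI allI impI)
  show "continuous_on K (\<lambda>x. x $ i)"
    by (intro continuous_intros)
  fix A :: "(real ^ 'a \<Rightarrow> real) set"
  assume "coords \<subseteq> A" "jointly_approx \<rho> K A"
  moreover have "(\<lambda>x. x $ i) \<in> coords"
    by (simp add: coords_def)
  ultimately show "jointly_approx \<rho> K (insert (\<lambda>x. x $ i) A)"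
    by (metis insert_absorb subsetD)
qed

text \<open>A combination with zero coefficients of an arbitrary coordinate, whose index is
  \<open>undefined\<close>.\<close>

lemma computable_const: "(\<lambda>x. c) \<in> computable \<rho> K"
  using computable_linear[OF computable_coord computable_coord, of 0 undefined 0 undefined c] by simp

lemma computable_limit:
  assumes "continuous_on K F"
    and "\<And>e. 0 < e \<Longrightarrow> \<exists>G\<in>computable \<rho> K. \<forall>x\<in>K. \<bar>G x - F x\<bar> < e"
  shows "F \<in> computable \<rho> K"
  unfolding computable_def
proof (intro CollectI conjI allI impI assms(1))
  fix A :: "(real ^ 'a \<Rightarrow> real) set"
  assume A: "finite A" "\<forall>G\<in>A. continuous_on K G" "coords \<subseteq> A" "jointly_approx \<rho> K A"
  show "jointly_approx \<rho> K (insert F A)"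
  proof (rule jointly_approx_limit)
    fix e :: real
    assume "0 < e"
    then obtain G where "G \<in> computable \<rho> K" "\<forall>x\<in>K. \<bar>G x - F x\<bar> < e"
      using assms(2) by blast
    then show "\<exists>G. jointly_approx \<rho> K (insert G A) \<and> (\<forall>x\<in>K. \<bar>G x - F x\<bar> < e)"
      using A by (auto intro: computable_insert)
  qed
qed

section \<open>Closure properties of the applicable functions\<close>

lemma compact_continuous_bound:
  fixes F :: "'a :: topological_space \<Rightarrow> real"
  assumes "compact K" "continuous_on K F"
  obtains M where "\<And>x. x \<in> K \<Longrightarrow> \<bar>F x\<bar> \<le> M"
  using compact_imp_bounded[OF compact_continuous_image[OF assms(2,1)]]
  unfolding bounded_iff by auto

lemma applicable_activation:
  assumes "compact K" "continuous_on UNIV \<rho>" "(\<rho> has_real_derivative r) (at p)" "r \<noteq> 0"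
  shows "\<rho> \<in> applicable \<rho> K"
proof -
  have "(\<lambda>x. \<rho> (F x)) \<in> computable \<rho> K" if F: "F \<in> computable \<rho> K" for F :: "real ^ 'a \<Rightarrow> real"
    unfolding computable_def
  proof (intro CollectI conjI allI impI)
    show "continuous_on K (\<lambda>x. \<rho> (F x))"
      using continuous_on_compose2[OF assms(2) computable_continuous[OF F]] by simp
    fix A :: "(real ^ 'a \<Rightarrow> real) set"
    assume A: "finite A" "\<forall>G\<in>A. continuous_on K G" "coords \<subseteq> A" "jointly_approx \<rho> K A"
    then have FA: "jointly_approx \<rho> K (insert F A)"
      by (intro computable_insert[OF F]) auto
    have "\<exists>M. \<forall>x\<in>K. \<bar>G x\<bar> \<le> M" if "G \<in> insert F A" for G
      using compact_continuous_bound[OF assms(1), of G] A(2) computable_continuous[OF F] that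
      by (metis insertE)
    then obtain M where M: "\<And>G x. G \<in> insert F A \<Longrightarrow> x \<in> K \<Longrightarrow> \<bar>G x\<bar> \<le> M G"
      by metis
    \<comment> \<open>A single bound for the whole family, since one zoom factor must serve all its
      members.\<close>
    have "\<bar>G x\<bar> \<le> Max (M ` insert F A)" if "G \<in> insert F A" "x \<in> K" for G x
    proof -
      have "M G \<le> Max (M ` insert F A)"
        using A(1) that(1) by (intro Max_ge) auto
      then show ?thesis
        using M[OF that] by linarith
    qed
    then have "jointly_approx \<rho> K (insert (\<lambda>x. \<rho> (F x)) (insert F A))"
      by (intro jointly_approx_activation[OF FA _ _ assms(2-4)]) auto
    then show "jointly_approx \<rho> K (insert (\<lambda>x. \<rho> (F x)) A)"
      by (rule jointly_approx_mono) auto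
  qed
  then show ?thesis
    using assms(2) by (simp add: applicable_def)
qed

lemma applicable_linear:
  assumes "G \<in> applicable \<rho> K" "H \<in> applicable \<rho> K"
  shows "(\<lambda>y. a * G y + b * H y + c) \<in> applicable \<rho> K"
  using assms by (simp add: applicable_def computable_linear continuous_intros)

lemma applicable_ident: "(\<lambda>y. y) \<in> applicable \<rho> K"
  by (simp add: applicable_def)

lemma applicable_sum:
  assumes "\<And>k. k < N \<Longrightarrow> G k \<in> applicable \<rho> K"
  shows "(\<lambda>y. \<Sum>k<(N :: nat). c * G k y) \<in> applicable \<rho> K"
  using assms
proof (induction N)
  case 0
  then show ?case
    by (simp add: applicable_def computable_const)
next
  case (Suc N)
  then have "(\<lambda>y. 1 * (\<Sum>k<N. c * G k y) + c * G N y + 0) \<in> applicable \<rho> K"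
    by (intro applicable_linear) auto
  then show ?case by simp
qed

lemma applicable_affine_comp:
  assumes "G \<in> applicable \<rho> K"
  shows "(\<lambda>y. G (t * y + c)) \<in> applicable \<rho> K"
proof -
  have "(\<lambda>x. G (t * F x + c)) \<in> computable \<rho> K" if "F \<in> computable \<rho> K" for F :: "real ^ 'a \<Rightarrow> real"
  proof -
    have "(\<lambda>x. t * F x + c) \<in> computable \<rho> K"
      using computable_linear[OF that that, of t 0 c] by simp
    then show ?thesis
      using assms unfolding applicable_def by fastforce
  qed
  moreover have "continuous_on UNIV (\<lambda>y. G (t * y + c))"
    by (rule continuous_on_compose2[where t = UNIV and g = G])
      (use assms in \<open>auto simp: applicable_def intro!: continuous_intros\<close>)
  ultimately show ?thesis
    by (simp add: applicable_def)
qed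

text \<open>Uniform approximation on bounded intervals suffices because a computable
  \<open>F\<close> is bounded on the compact set \<open>K\<close>.\<close>

lemma applicable_limit:
  assumes "compact K" "continuous_on UNIV G"
    and "\<And>e M. 0 < e \<Longrightarrow> \<exists>H\<in>applicable \<rho> K. \<forall>y. \<bar>y\<bar> \<le> M \<longrightarrow> \<bar>H y - G y\<bar> < e"
  shows "G \<in> applicable \<rho> K"
proof -
  have "(\<lambda>x. G (F x)) \<in> computable \<rho> K" if F: "F \<in> computable \<rho> K" for F :: "real ^ 'a \<Rightarrow> real"
  proof (rule computable_limit)
    show "continuous_on K (\<lambda>x. G (F x))"
      using continuous_on_compose2[OF assms(2) computable_continuous[OF F]] by simp
    fix e :: real
    assume "0 < e"
    obtain M where M: "\<And>x. x \<in> K \<Longrightarrow> \<bar>F x\<bar> \<le> M"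
      using compact_continuous_bound[OF assms(1) computable_continuous[OF F]] by blast
    obtain H where "H \<in> applicable \<rho> K" "\<forall>y. \<bar>y\<bar> \<le> M \<longrightarrow> \<bar>H y - G y\<bar> < e"
      using assms(3)[OF \<open>0 < e\<close>] by blast
    then show "\<exists>H\<in>computable \<rho> K. \<forall>x\<in>K. \<bar>H x - G (F x)\<bar> < e"
      using M F by (intro bexI[of _ "\<lambda>x. H (F x)"]) (auto simp: applicable_def)
  qed
  then show ?thesis
    using assms(2) by (simp add: applicable_def)
qed

text \<open>Up to the factor \<open>h\<close> this is the average of \<open>G\<close> over
  \<open>{y..y + h}\<close>, a limit of Riemann sums, which are linear combinations of translates of
  \<open>G\<close>.\<close>

lemma applicable_increment:
  assumes "compact K" "G \<in> applicable \<rho> K" "\<And>x. (P has_real_derivative G x) (at x)" "0 < h"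
  shows "(\<lambda>y. P (y + h) - P y) \<in> applicable \<rho> K"
proof (rule applicable_limit[OF assms(1)])
  have P: "continuous_on UNIV P"
    by (rule DERIV_continuous_on) (rule assms(3))
  have "continuous_on UNIV (\<lambda>y. P (y + h))"
    by (rule continuous_on_compose2[OF P]) (auto intro!: continuous_intros)
  then show "continuous_on UNIV (\<lambda>y. P (y + h) - P y)"
    by (intro continuous_on_diff P)
  fix e M :: real
  assume "0 < e"
  have "continuous_on UNIV G"
    using assms(2) by (simp add: applicable_def)
  then obtain N where N: "\<And>y. \<bar>y\<bar> \<le> M \<Longrightarrow>
      \<bar>(P (y + h) - P y) - (\<Sum>k<N. h / real N * G (y + real k * (h / real N)))\<bar> < e"
    using riemann_sum_near_increment[OF _ assms(3,4) \<open>0 < e\<close>] by metis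
  have "(\<lambda>y. G (1 * y + real k * (h / real N))) \<in> applicable \<rho> K" for k
    by (rule applicable_affine_comp[OF assms(2)])
  then have "(\<lambda>y. \<Sum>k<N. h / real N * G (1 * y + real k * (h / real N))) \<in> applicable \<rho> K"
    by (intro applicable_sum)
  then show "\<exists>H\<in>applicable \<rho> K. \<forall>y. \<bar>y\<bar> \<le> M \<longrightarrow> \<bar>H y - (P (y + h) - P y)\<bar> < e"
    using N by (intro bexI) (auto simp: abs_minus_commute)
qed

lemma applicable_square:
  assumes "compact K" "continuous_on UNIV \<rho>" "\<not> affine_fun \<rho>"
    and "(\<rho> has_real_derivative r) (at p)" "r \<noteq> 0"
  shows "(\<lambda>y. y\<^sup>2) \<in> applicable \<rho> K"
proof -
  \<comment> \<open>The same \<open>h\<close> serves as the length of both averaging intervals, so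
    that this second difference becomes \<open>s'' q\<close>.\<close>
  obtain q h where h: "0 < h" "\<rho> (q + 2 * h) - 2 * \<rho> (q + h) + \<rho> q \<noteq> 0"
    using affine_fun_if_second_differences_zero[OF assms(2)] assms(3) by blast
  obtain P where P: "\<And>x. (P has_real_derivative \<rho> x) (at x)"
    using antiderivative_exists[OF assms(2)] by blast
  have "continuous_on UNIV P"
    by (rule DERIV_continuous_on) (rule P)
  then obtain Q where Q: "\<And>x. (Q has_real_derivative P x) (at x)"
    using antiderivative_exists by blast
  have shift: "((\<lambda>x. Z (x + h)) has_real_derivative z (x + h)) (at x)"
    if "\<And>x. (Z has_real_derivative z x) (at x)" for Z z x
    using that DERIV_shift by blast
  \<comment> \<open>Up to factors \<open>h\<close>, \<open>s1\<close> is the average of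
    \<open>\<rho>\<close> and \<open>s\<close> that of \<open>s1\<close>; \<open>v\<close> is an
    antiderivative of \<open>s1\<close>.\<close>
  define s1 where "s1 y = P (y + h) - P y" for y
  define v where "v y = Q (y + h) - Q y" for y
  define s where "s y = v (y + h) - v y" for y
  define s' where "s' y = s1 (y + h) - s1 y" for y
  define s'' where "s'' y = \<rho> (y + h + h) - \<rho> (y + h) - (\<rho> (y + h) - \<rho> y)" for y
  have v: "(v has_real_derivative s1 y) (at y)" for y
    unfolding v_def s1_def by (intro DERIV_diff shift Q)
  have s: "(s has_real_derivative s' y) (at y)" for y
    unfolding s_def s'_def by (intro DERIV_diff shift v)
  have s1: "(s1 has_real_derivative \<rho> (y + h) - \<rho> y) (at y)" for y
    unfolding s1_def by (intro DERIV_diff shift P)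
  have s': "(s' has_real_derivative s'' y) (at y)" for y
    unfolding s'_def s''_def by (intro DERIV_diff shift s1)
  have "isCont \<rho> y" for y
    using assms(2) by (simp add: continuous_on_eq_continuous_at)
  then have "isCont (\<lambda>y. \<rho> (u y)) q" if "isCont u q" for u :: "real \<Rightarrow> real"
    by (rule isCont_o2[OF that])
  then have cont: "isCont s'' q"
    unfolding s''_def by (auto intro!: continuous_intros)
  have nz: "s'' q \<noteq> 0"
    using h(2) by (simp add: s''_def algebra_simps)
  have "\<rho> \<in> applicable \<rho> K"
    by (rule applicable_activation[OF assms(1,2,4,5)])
  then have "s1 \<in> applicable \<rho> K"
    unfolding s1_def by (rule applicable_increment[OF assms(1) _ P h(1)])
  then have s_app: "s \<in> applicable \<rho> K"
    unfolding s_def by (rule applicable_increment[OF assms(1) _ v h(1)])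
  show ?thesis
  proof (rule applicable_limit[OF assms(1)])
    show "continuous_on UNIV (\<lambda>y :: real. y\<^sup>2)"
      by (intro continuous_intros)
    fix e M :: real
    assume "0 < e"
    then obtain t where t: "\<And>y. \<bar>y\<bar> \<le> M \<Longrightarrow>
        \<bar>2 * (s (q + t * y) - s q - s' q * (t * y)) / (t\<^sup>2 * s'' q) - y\<^sup>2\<bar> < e"
      using second_order_quotient_near_square[OF s s' cont nz] by metis
    \<comment> \<open>The second-order quotient is \<open>a\<close> times a zoomed copy of
      \<open>s\<close>, minus its first-order Taylor polynomial; the latter is available through the
      identity function and constants.\<close>
    define a where "a = 2 / (t\<^sup>2 * s'' q)"
    have "(\<lambda>y. a * s (t * y + q) + (- a * s' q * t) * y + (- a * s q)) \<in> applicable \<rho> K"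
      by (intro applicable_linear applicable_affine_comp s_app applicable_ident)
    also have "(\<lambda>y. a * s (t * y + q) + (- a * s' q * t) * y + (- a * s q)) =
        (\<lambda>y. 2 * (s (q + t * y) - s q - s' q * (t * y)) / (t\<^sup>2 * s'' q))"
    proof
      fix y
      have "2 * (s (q + t * y) - s q - s' q * (t * y)) / (t\<^sup>2 * s'' q) =
          a * (s (t * y + q) - s q - s' q * (t * y))"
        by (simp add: a_def add.commute)
      then show "a * s (t * y + q) + (- a * s' q * t) * y + (- a * s q) =
          2 * (s (q + t * y) - s q - s' q * (t * y)) / (t\<^sup>2 * s'' q)"
        by (simp add: right_diff_distrib)
    qed
    finally show "\<exists>H\<in>applicable \<rho> K. \<forall>y. \<bar>y\<bar> \<le> M \<longrightarrow> \<bar>H y - y\<^sup>2\<bar> < e"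
      by (rule bexI[rotated]) (use t in blast)
  qed
qed

section \<open>Density in the continuous functions\<close>

text \<open>Squares give products, so the computable functions form an algebra; it contains the
  constants, and the coordinates separate points, so Stone-Weierstrass applies. Closure under
  uniform limits turns density into equality.\<close>

lemma computable_if_continuous:
  assumes "compact K" "continuous_on UNIV \<rho>" "\<not> affine_fun \<rho>"
    and "(\<rho> has_real_derivative r) (at p)" "r \<noteq> 0"
    and "continuous_on K F"
  shows "F \<in> computable \<rho> K"
proof (rule computable_limit[OF assms(6)])
  fix e :: real
  assume "0 < e"
  have square: "(\<lambda>x. (G x)\<^sup>2) \<in> computable \<rho> K" if "G \<in> computable \<rho> K" for G :: "real ^ 'a \<Rightarrow> real"
    using applicable_square[OF assms(1-5)] that unfolding applicable_def by blast
  interpret function_ring_on "computable \<rho> K" K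
  proof
    show add: "(\<lambda>x. G x + H x) \<in> computable \<rho> K"
      if "G \<in> computable \<rho> K" "H \<in> computable \<rho> K" for G H :: "real ^ 'a \<Rightarrow> real"
      using computable_linear[OF that, of 1 1 0] by simp
    show "(\<lambda>x. G x * H x) \<in> computable \<rho> K"
      if "G \<in> computable \<rho> K" "H \<in> computable \<rho> K" for G H :: "real ^ 'a \<Rightarrow> real"
    proof -
      \<comment> \<open>Polarization, nested in the form of
        \<open>computable_linear\<close>.\<close>
      have "(\<lambda>x. 1 * (1 / 2 * (G x + H x)\<^sup>2 + (- 1 / 2) * (G x)\<^sup>2 + 0) + (- 1 / 2) * (H x)\<^sup>2 + 0) \<in> computable \<rho> K"
        by (intro computable_linear square add that)
      then show ?thesis
        by (simp add: power2_eq_square algebra_simps)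
    qed
    show "\<exists>G\<in>computable \<rho> K. G x \<noteq> G y" if "x \<noteq> y" for x y :: "real ^ 'a"
      using that computable_coord by (metis vec_eq_iff)
  qed (use assms(1) computable_const computable_continuous in auto)
  obtain G where "G \<in> UNIV \<rightarrow> computable \<rho> K" "uniform_limit K G F sequentially"
    using Stone_Weierstrass[OF assms(6)] by auto
  then have "\<forall>\<^sub>F n in sequentially. \<forall>x\<in>K. dist (G n x) (F x) < e"
    using \<open>0 < e\<close> uniform_limitD by blast
  then obtain n where "\<forall>x\<in>K. dist (G n x) (F x) < e"
    unfolding eventually_sequentially by blast
  then show "\<exists>G\<in>computable \<rho> K. \<forall>x\<in>K. \<bar>G x - F x\<bar> < e"
    using \<open>G \<in> UNIV \<rightarrow> computable \<rho> K\<close> unfolding dist_real_def by blast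
qed

theorem universal_approximation:
  fixes K :: "(real ^ 'n) set"
  assumes "compact K" "continuous_on UNIV \<rho>" "\<not> affine_fun \<rho>"
    and "(\<rho> has_real_derivative r) (at p)" "r \<noteq> 0"
    and "continuous_on K F" "0 < e"
  obtains g where "feedforward_network \<rho> g" "\<And>x. x \<in> K \<Longrightarrow> \<bar>g x - F x\<bar> < e"
proof -
  have "finite (coords :: (real ^ 'n \<Rightarrow> real) set)"
    by (simp add: coords_def)
  moreover have "continuous_on K G" if "G \<in> coords" for G
    using that by (auto simp: coords_def intro!: continuous_intros)
  ultimately have "jointly_approx \<rho> K (insert F coords)"
    by (intro computable_insert computable_if_continuous[OF assms(1-6)] jointly_approx_coords) auto
  then obtain k h where h: "layers \<rho> k h"
    "\<And>G. G \<in> insert F coords \<Longrightarrow> \<exists>i<k. \<forall>x\<in>K. \<bar>h x i - G x\<bar> < e"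
    using jointly_approxE assms(7) by blast
  then obtain i where i: "i < k" "\<forall>x\<in>K. \<bar>h x i - F x\<bar> < e"
    by blast
  \<comment> \<open>Projection to the one component that approximates \<open>F\<close>.\<close>
  have "layers \<rho> 1 (\<lambda>x _. (\<Sum>j<k. (if i = j then 1 else 0) * h x j) + 0)"
    by (rule layers_affine[OF h(1)])
  then have "layers \<rho> 1 (\<lambda>x _. h x i)"
    by (simp only: sum_diagonal[OF i(1)] mult_1 add_0_right)
  then have "feedforward_network \<rho> (\<lambda>x. h x i)"
    unfolding feedforward_network_def by blast
  then show thesis
    using that i(2) by blast
qed

section \<open>Separated classes\<close>

text \<open>The closure is topological while the balls are those of \<open>d\<close>. Continuity of
  \<open>d\<close> puts each point of a closure at \<open>d\<close>-distance less than
  \<open>s / 2\<close> from the set of centres, so a common point would contradict the gap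
  \<open>s\<close>.\<close>

lemma closure_neighbourhoods_disjoint:
  fixes d :: "'a :: topological_space \<Rightarrow> 'a \<Rightarrow> real"
  assumes "Metric_space UNIV d" "continuous_on UNIV (\<lambda>(x, y). d x y)"
    and "2 * \<epsilon> < s" "\<And>x y. x \<in> A \<Longrightarrow> y \<in> B \<Longrightarrow> s < d x y"
  shows "closure (\<Union>x\<in>A. nbhd d \<epsilon> x) \<inter> closure (\<Union>x\<in>B. nbhd d \<epsilon> x) = {}"
proof -
  interpret Metric_space UNIV d by fact
  \<comment> \<open>The slack for passing to the closure: \<open>\<epsilon> + \<eta>\<close> is half
    the gap.\<close>
  define \<eta> where "\<eta> = s / 2 - \<epsilon>"
  have "0 < \<eta>"
    using assms(3) by (simp add: \<eta>_def)
  have near: "\<exists>x\<in>S. d x y < \<epsilon> + \<eta>" if "y \<in> closure (\<Union>x\<in>S. nbhd d \<epsilon> x)" for y and S :: "'a set"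
  proof -
    have "continuous_on UNIV (\<lambda>z. (y, z))"
      by (rule continuous_on_Pair[OF continuous_on_const continuous_on_id])
    then have "continuous_on UNIV (\<lambda>z. d y z)"
      using continuous_on_compose2[OF assms(2)] by fastforce
    then have "open {z. d y z < \<eta>}"
      by (intro open_Collect_less continuous_intros)
    moreover have "y \<in> {z. d y z < \<eta>}"
      using \<open>0 < \<eta>\<close> by simp
    ultimately obtain z where z: "z \<in> (\<Union>x\<in>S. nbhd d \<epsilon> x)" "d y z < \<eta>"
      using open_Int_closure_eq_empty[of "{z. d y z < \<eta>}"] \<open>y \<in> closure _\<close> by blast
    then obtain x where x: "x \<in> S" "d x z \<le> \<epsilon>"
      by auto
    have "d x y \<le> d x z + d y z"
      using triangle[of x z y] by (simp add: commute)
    then show ?thesis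
      using x z by force
  qed
  have False if y: "y \<in> closure (\<Union>x\<in>A. nbhd d \<epsilon> x)" "y \<in> closure (\<Union>x\<in>B. nbhd d \<epsilon> x)" for y
  proof -
    obtain x where x: "x \<in> A" "d x y < \<epsilon> + \<eta>"
      using near[OF y(1)] by blast
    obtain x' where x': "x' \<in> B" "d x' y < \<epsilon> + \<eta>"
      using near[OF y(2)] by blast
    have "d x x' \<le> d x y + d x' y"
      using triangle[of x y x'] by (simp add: commute)
    then show False
      using assms(4)[OF x(1) x'(1)] x x' by (simp add: \<eta>_def field_simps)
  qed
  then show ?thesis by blast
qed

text \<open>Disjointness makes the label well defined, and continuity on finitely many closed sets
  passes to their union.\<close>

lemma locally_constant_continuous_on:
  fixes E :: "nat \<Rightarrow> 'a :: topological_space set"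
  assumes "finite I" "\<And>c. c \<in> I \<Longrightarrow> closed (E c)"
    and "\<And>i j. i \<in> I \<Longrightarrow> j \<in> I \<Longrightarrow> i \<noteq> j \<Longrightarrow> E i \<inter> E j = {}"
  obtains F :: "'a \<Rightarrow> real" where "continuous_on (\<Union>c\<in>I. E c) F"
    "\<And>c y. c \<in> I \<Longrightarrow> y \<in> E c \<Longrightarrow> F y = real c"
proof -
  define F where "F y = real (THE c. c \<in> I \<and> y \<in> E c)" for y
  have F: "F y = real c" if "c \<in> I" "y \<in> E c" for c y
  proof -
    have "(THE c. c \<in> I \<and> y \<in> E c) = c"
      using that assms(3) by (intro the_equality) blast+
    then show ?thesis by (simp add: F_def)
  qed
  have "continuous_on (E c) F" if "c \<in> I" for c
    using F[OF that] by (subst continuous_on_cong[OF refl, of _ _ "\<lambda>_. real c"]) auto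
  then have "continuous_on (\<Union>c\<in>I. E c) F"
    by (intro continuous_on_closed_Union assms(1,2))
  then show thesis
    using F that by blast
qed

text \<open>The two named assumptions supplement the informal statement: \<open>d_continuous\<close>
  links \<open>d\<close> to the usual topology, so that separation survives closure, and
  \<open>nbhd_bounded\<close> makes the union of the closed class neighbourhoods compact.\<close>

theorem theorem2:
  fixes \<rho> :: "real \<Rightarrow> real"
    and D :: "(real ^ 'n) measure"
    and X :: "(real ^ 'n) set"
    and f :: "real ^ 'n \<Rightarrow> nat"
    and C :: nat
    and d :: "real ^ 'n \<Rightarrow> real ^ 'n \<Rightarrow> real"
    and \<epsilon> :: real
  assumes "continuous_on UNIV \<rho>"
    and "\<not> affine_fun \<rho>"
    and "\<exists>a. cont_diff_nonzero_at \<rho> a"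
    and "prob_space D" and "space D = X"
    and "f \<in> X \<rightarrow> {1..C}"
    and "Metric_space UNIV d"
    and "0 \<le> \<epsilon>"
    and "class_separation X f d > ereal (2 * \<epsilon>)"
    and d_continuous: "continuous_on UNIV (\<lambda>(x, y). d x y)"
    and nbhd_bounded: "bounded (\<Union>x\<in>X. nbhd d \<epsilon> x)"
  shows "\<exists>g. feedforward_network \<rho> g \<and> robust_accuracy D f d \<epsilon> g = 1"
proof -
  interpret prob_space D by fact
  obtain p r where deriv: "(\<rho> has_real_derivative r) (at p)" "r \<noteq> 0"
    using assms(3) unfolding cont_diff_nonzero_at_def by (meson eventually_nhds_x_imp_x)
  define E where "E c = closure (\<Union>x\<in>class_points X f c. nbhd d \<epsilon> x)" for c
  \<comment> \<open>A real number strictly in between exists even if the infimum is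
    infinite.\<close>
  obtain s where s: "ereal (2 * \<epsilon>) < ereal s" "ereal s < class_separation X f d"
    using ereal_dense2[OF assms(9)] by blast
  have "s < d x y" if "x \<in> class_points X f i" "y \<in> class_points X f j" "i \<noteq> j" for x y i j
  proof -
    have "class_separation X f d \<le> ereal (d x y)"
      unfolding class_separation_def by (rule Inf_lower) (use that in blast)
    then show ?thesis
      using s(2) by (metis ereal_less_eq(3) leD leI order_trans)
  qed
  then have disjoint: "E i \<inter> E j = {}" if "i \<noteq> j" for i j
    unfolding E_def using that s(1)
    by (intro closure_neighbourhoods_disjoint[OF assms(7) d_continuous, of _ s]) auto
  define K where "K = (\<Union>c\<in>{1..C}. E c)"
  have "bounded (E c)" for c
    unfolding E_def
    by (intro bounded_closure bounded_subset[OF nbhd_bounded]) (auto simp: class_points_def)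
  then have "compact K"
    unfolding K_def by (intro compact_UN) (auto simp: compact_eq_bounded_closed E_def)
  obtain F where F: "continuous_on K F" "\<And>c y. c \<in> {1..C} \<Longrightarrow> y \<in> E c \<Longrightarrow> F y = real c"
    unfolding K_def
    by (rule locally_constant_continuous_on[of "{1..C}" E]) (use disjoint in \<open>auto simp: E_def\<close>)
  obtain g where g: "feedforward_network \<rho> g" "\<And>x. x \<in> K \<Longrightarrow> \<bar>g x - F x\<bar> < 1 / 2"
    using universal_approximation[OF \<open>compact K\<close> assms(1,2) deriv F(1), of "1 / 2"] by auto
  have "\<bar>g y - real (f x)\<bar> < 1 / 2" if "x \<in> X" "y \<in> nbhd d \<epsilon> x" for x y
  proof -
    have "y \<in> (\<Union>x\<in>class_points X f (f x). nbhd d \<epsilon> x)"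
      using that by (auto simp: class_points_def)
    then have "y \<in> E (f x)"
      unfolding E_def by (rule subsetD[OF closure_subset])
    moreover have "f x \<in> {1..C}"
      using assms(6) that(1) by blast
    ultimately have "F y = real (f x)" "y \<in> K"
      using F(2) unfolding K_def by blast+
    then show ?thesis
      using g(2)[of y] by simp
  qed
  \<comment> \<open>Every data point is classified robustly, so the set is the whole space and in
    particular measurable.\<close>
  then have "{x \<in> space D. \<forall>y \<in> nbhd d \<epsilon> x. \<bar>g y - real (f x)\<bar> < 1 / 2} = space D"
    using assms(5) by blast
  then have "robust_accuracy D f d \<epsilon> g = 1"
    by (simp add: robust_accuracy_def prob_space)
  then show ?thesis
    using g(1) by blast
qed

end
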